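(* For every Boolean function $f:\{-1,1\}^n\to\{-1,1\}$ and every red--blue coloring $\chi$ of the sensitive edges of $f$, $$\mathsf B(f)\le\mathsf T_{\rm frac}(f)\le\mathsf T_{\rm col}(f)\le\mathsf T_{\rm col}^\chi(f).$$ In particular, $\mathsf B(f)\le\mathsf T_{\rm col}^\chi(f)$ for every red--blue coloring $\chi$, and $$\mathsf B(f)\le\mathbb E\sqrt{h_{\{f=1\}}},\qquad \mathsf B(f)\le\mathbb E\sqrt{h_{\{f=-1\}}}.$$
   Context: $\{-1,1\}^n$ carries the uniform probability measure. $x^{\oplus i}$ is $x$ with the $i$th coordinate flipped. $D_ig(x)=\frac{g(x)-g(x^{\oplus i})}2$, $L=\sum_{i=1}^n D_i$. A vector field is a map $V=(V_1,\dots,V_n):\{-1,1\}^n\to\mathbb R^n$, with $\operatorname{div}V(x)=\sum_{i=1}^n(V_i(x)-V_i(x^{\oplus i}))$. The Beckmann boundary is $\mathsf B(f)=\inf\{\mathbb E\|V(x)\|_2:\operatorname{div}V=Lf\}$ ($\|\cdot\|_2$ Euclidean norm). For $A\subset\{-1,1\}^n$, $h_A(x)=\#\{i:x\in A,\ x^{\oplus i}\notin A\}$. For Boolean $f$ let $E_f$ be the set of sensitive edges, i.e. edges $\{x,x^{\oplus i}\}$ of the cube with $f(x)\ne f(x^{\oplus i})$. For a coloring $\chi:E_f\to\{\text{red},\text{blue}\}$ let $s_{f,\rm red}(x)=\#\{i: f(x)=1,\ f(x^{\oplus i})=-1,\ \{x,x^{\oplus i}\}\text{ red}\}$ and $s_{f,\rm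 blue}(x)=\#\{i: f(x)=-1,\ f(x^{\oplus i})=1,\ \{x,x^{\oplus i}\}\text{ blue}\}$, and $\mathsf T_{\rm col}^\chi(f)=\mathbb E\sqrt{s_{f,\rm red}}+\mathbb E\sqrt{s_{f,\rm blue}}$. Put $\mathsf T_{\rm col}(f)=\inf_\chi \mathsf T_{\rm col}^\chi(f)$. For a fractional coloring $\theta:E_f\to[0,1]$ let $$\mathsf T_\theta(f)=\mathbb E_x\Big(\sum_{i:\,f(x)=1,\,f(x^{\oplus i})=-1}\theta_{\{x,x^{\oplus i}\}}^2+\sum_{i:\,f(x)=-1,\,f(x^{\oplus i})=1}(1-\theta_{\{x,x^{\oplus i}\}})^2\Big)^{1/2},$$ and $\mathsf T_{\rm frac}(f)=\inf_\theta\mathsf T_\theta(f)$. *)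

theory Defs
  imports "HOL-Probability.Probability"
begin

text \<open>
  The discrete cube is the set of sign vectors inside \<^typ>\<open>real ^ 'n\<close>, with n = CARD('n).
  Functions on the cube are total functions on \<^typ>\<open>real ^ 'n\<close>; only their values on the cube
  enter the definitions below.
\<close>

definition cube :: "(real ^ 'n) set" where
  "cube = {x. \<forall>i. x $ i \<in> {-1, 1}}"

lemma finite_cube: "finite (cube :: (real ^ 'n::finite) set)"
proof -
  have "finite (PiE (UNIV :: 'n set) (\<lambda>_. {-1, 1 :: real}))"
    by (intro finite_PiE) auto
  moreover have "cube \<subseteq> vec_lambda ` (PiE (UNIV :: 'n set) (\<lambda>_. {-1, 1 :: real}))"
  proof
    fix x :: "real ^ 'n" assume "x \<in> cube"
    then have "vec_nth x \<in> PiE UNIV (\<lambda>_. {-1, 1})" by (auto simp: cube_def)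
    then show "x \<in> vec_lambda ` PiE UNIV (\<lambda>_. {-1, 1})"
      by (metis image_eqI vec_nth_inverse)
  qed
  ultimately show ?thesis by (rule rev_finite_subset[OF finite_imageI])
qed

lemma cube_nonempty: "(cube :: (real ^ 'n) set) \<noteq> {}"
proof -
  have "((\<chi> i. 1) :: real ^ 'n) \<in> cube" by (simp add: cube_def)
  then show ?thesis by blast
qed

definition flip :: "real ^ 'n \<Rightarrow> 'n \<Rightarrow> real ^ 'n" where
  "flip x i = (\<chi> j. if j = i then - x $ j else x $ j)"

definition cube_expectation :: "(real ^ 'n \<Rightarrow> real) \<Rightarrow> real" where
  "cube_expectation g = measure_pmf.expectation (pmf_of_set cube) g"

definition disc_deriv :: "'n \<Rightarrow> (real ^ 'n \<Rightarrow> real) \<Rightarrow> real ^ 'n \<Rightarrow> real" where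
  "disc_deriv i g x = (g x - g (flip x i)) / 2"

definition laplacian :: "(real ^ 'n \<Rightarrow> real) \<Rightarrow> real ^ 'n \<Rightarrow> real" where
  "laplacian g x = (\<Sum>i\<in>UNIV. disc_deriv i g x)"

definition divergence :: "(real ^ 'n \<Rightarrow> real ^ 'n) \<Rightarrow> real ^ 'n \<Rightarrow> real" where
  "divergence V x = (\<Sum>i\<in>UNIV. V x $ i - V (flip x i) $ i)"

text \<open>
  The three infima below are taken in the reals: every set is bounded below by 0, and nonempty
  (for the Beckmann boundary, the field with components \<open>disc_deriv i f / 2\<close> is admissible).
\<close>

definition beckmann :: "(real ^ 'n \<Rightarrow> real) \<Rightarrow> real" where
  "beckmann f = Inf {cube_expectation (\<lambda>x. norm (V x)) | V :: real ^ 'n \<Rightarrow> real ^ 'n.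
     \<forall>x\<in>cube. divergence V x = laplacian f x}"

definition boundary_degree :: "(real ^ 'n) set \<Rightarrow> real ^ 'n \<Rightarrow> nat" where
  "boundary_degree A x = card {i. x \<in> A \<and> flip x i \<notin> A}"

definition sensitive_edges :: "(real ^ 'n \<Rightarrow> real) \<Rightarrow> (real ^ 'n) set set" where
  "sensitive_edges f = {{x, flip x i} | x i. x \<in> cube \<and> f x \<noteq> f (flip x i)}"

datatype color = Red | Blue

definition s_red :: "(real ^ 'n \<Rightarrow> real) \<Rightarrow> ((real ^ 'n) set \<Rightarrow> color) \<Rightarrow> real ^ 'n \<Rightarrow> nat" where
  "s_red f c x = card {i. f x = 1 \<and> f (flip x i) = -1 \<and> c {x, flip x i} = Red}"

definition s_blue :: "(real ^ 'n \<Rightarrow> real) \<Rightarrow> ((real ^ 'n) set \<Rightarrow> color) \<Rightarrow> real ^ 'n \<Rightarrow> nat" where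
  "s_blue f c x = card {i. f x = -1 \<and> f (flip x i) = 1 \<and> c {x, flip x i} = Blue}"

definition talagrand_coloring :: "(real ^ 'n \<Rightarrow> real) \<Rightarrow> ((real ^ 'n) set \<Rightarrow> color) \<Rightarrow> real" where
  "talagrand_coloring f c =
     cube_expectation (\<lambda>x. sqrt (real (s_red f c x))) +
     cube_expectation (\<lambda>x. sqrt (real (s_blue f c x)))"

definition talagrand_col :: "(real ^ 'n \<Rightarrow> real) \<Rightarrow> real" where
  "talagrand_col f = (INF c \<in> sensitive_edges f \<rightarrow> {Red, Blue}. talagrand_coloring f c)"

definition talagrand_fractional :: "(real ^ 'n \<Rightarrow> real) \<Rightarrow> ((real ^ 'n) set \<Rightarrow> real) \<Rightarrow> real" where
  "talagrand_fractional f \<theta> = cube_expectation (\<lambda>x. sqrt (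
     (\<Sum>i | f x = 1 \<and> f (flip x i) = -1. (\<theta> {x, flip x i})\<^sup>2) +
     (\<Sum>i | f x = -1 \<and> f (flip x i) = 1. (1 - \<theta> {x, flip x i})\<^sup>2)))"

definition talagrand_frac :: "(real ^ 'n \<Rightarrow> real) \<Rightarrow> real" where
  "talagrand_frac f = (INF \<theta> \<in> sensitive_edges f \<rightarrow> {0..1}. talagrand_fractional f \<theta>)"

end

theory Submission
  imports Defs
begin

text \<open>
  A fractional coloring \<open>\<theta>\<close> is a recipe for an admissible vector field. The
  equation \<open>div V = L f\<close> is satisfied as soon as one unit of flow crosses every sensitive edge from
  its endpoint in \<open>{f = 1}\<close> to its endpoint in \<open>{f = -1}\<close>, and nothing crosses the other edges; this
  unit may be shared between the two endpoints, and
  \<open>\<theta>\<close> says that the positive endpoint carries \<open>\<theta>\<close> and the negative one \<open>1 - \<theta>\<close>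
  (\<open>divergence_coloring_field\<close>). The Euclidean norm of this field at \<open>x\<close> is exactly the integrand of
  the fractional Talagrand functional (\<open>norm_coloring_field\<close>), so the Beckmann boundary is at most
  that functional for every \<open>\<theta>\<close>.

  A red--blue coloring is the extreme case \<open>\<theta> \<in> {0, 1}\<close>. Since a vertex cannot be a positive and
  a negative endpoint at once, one of the two counts of red and blue edges vanishes at each vertex,
  and the square root of their sum splits into the sum of the square roots
  (\<open>talagrand_fractional_indicator\<close>). Coloring all edges red, or all blue, leaves only the
  boundary seen from \<open>{f = 1}\<close>, or from \<open>{f = -1}\<close>.
\<close>

lemma cube_expectation_eq_average:
  fixes g :: "real ^ 'n \<Rightarrow> real"
  shows "cube_expectation g = (\<Sum>x\<in>cube. g x) / real (card (cube :: (real ^ 'n) set))"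
  unfolding cube_expectation_def by (rule integral_pmf_of_set[OF cube_nonempty finite_cube])

lemma cube_expectation_nonneg:
  assumes "\<And>x. x \<in> cube \<Longrightarrow> 0 \<le> g x"
  shows "0 \<le> cube_expectation g"
  unfolding cube_expectation_eq_average using assms by (intro divide_nonneg_nonneg sum_nonneg) auto

lemma cube_expectation_cong:
  assumes "\<And>x. x \<in> cube \<Longrightarrow> g x = h x"
  shows "cube_expectation g = cube_expectation h"
  unfolding cube_expectation_eq_average using assms by (simp cong: sum.cong)

lemma cube_expectation_add:
  "cube_expectation g + cube_expectation h = cube_expectation (\<lambda>x. g x + h x)"
  unfolding cube_expectation_eq_average by (simp add: sum.distrib add_divide_distrib)

lemma flip_flip [simp]: "flip (flip x i) i = x"
  by (simp add: flip_def vec_eq_iff)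

lemma flip_in_cube: "x \<in> cube \<Longrightarrow> flip x i \<in> cube"
  by (auto simp: flip_def cube_def)

lemma sign_cases_along_edge:
  assumes "f \<in> cube \<rightarrow> {-1, 1 :: real}" and "x \<in> cube"
  obtains "f x = 1" "f (flip x i) = 1" | "f x = 1" "f (flip x i) = -1"
    | "f x = -1" "f (flip x i) = 1" | "f x = -1" "f (flip x i) = -1"
  using assms flip_in_cube[OF assms(2), of i] by fastforce

definition coloring_field ::
  "(real ^ 'n \<Rightarrow> real) \<Rightarrow> ((real ^ 'n) set \<Rightarrow> real) \<Rightarrow> real ^ 'n \<Rightarrow> real ^ 'n" where
  "coloring_field f \<theta> x = (\<chi> i.
     if f x = 1 \<and> f (flip x i) = -1 then \<theta> {x, flip x i}
     else if f x = -1 \<and> f (flip x i) = 1 then - (1 - \<theta> {x, flip x i})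
     else 0)"

text \<open>
  In direction \<open>i\<close> the difference of the field across a sensitive edge is \<open>\<theta> + (1 - \<theta>)\<close> seen from
  the positive endpoint and minus that from the negative one, whatever \<open>\<theta>\<close> is; this is the
  discrete derivative of \<open>f\<close>.
\<close>

lemma divergence_coloring_field:
  assumes "f \<in> cube \<rightarrow> {-1, 1}" and "x \<in> cube"
  shows "divergence (coloring_field f \<theta>) x = laplacian f x"
  unfolding divergence_def laplacian_def
proof (rule sum.cong[OF refl])
  fix i
  show "coloring_field f \<theta> x $ i - coloring_field f \<theta> (flip x i) $ i = disc_deriv i f x"
    by (rule sign_cases_along_edge[OF assms, of i])
       (simp_all add: coloring_field_def disc_deriv_def insert_commute)
qed

lemma norm_coloring_field:
  "norm (coloring_field f \<theta> x) = sqrt (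
     (\<Sum>i | f x = 1 \<and> f (flip x i) = -1. (\<theta> {x, flip x i})\<^sup>2) +
     (\<Sum>i | f x = -1 \<and> f (flip x i) = 1. (1 - \<theta> {x, flip x i})\<^sup>2))"
proof -
  have "(\<Sum>i\<in>UNIV. (coloring_field f \<theta> x $ i)\<^sup>2) =
    (\<Sum>i\<in>UNIV. (if f x = 1 \<and> f (flip x i) = -1 then (\<theta> {x, flip x i})\<^sup>2 else 0) +
                (if f x = -1 \<and> f (flip x i) = 1 then (1 - \<theta> {x, flip x i})\<^sup>2 else 0))"
    by (intro sum.cong) (auto simp: coloring_field_def power2_commute)
  then show ?thesis
    by (simp add: norm_vec_def L2_set_def sum.distrib sum.If_cases)
qed

lemma beckmann_le_talagrand_fractional:
  assumes "f \<in> cube \<rightarrow> {-1, 1}"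
  shows "beckmann f \<le> talagrand_fractional f \<theta>"
  unfolding beckmann_def
proof (rule cInf_lower)
  show "talagrand_fractional f \<theta> \<in> {cube_expectation (\<lambda>x. norm (V x)) | V.
      \<forall>x\<in>cube. divergence V x = laplacian f x}"
    unfolding talagrand_fractional_def norm_coloring_field[symmetric]
    using divergence_coloring_field[OF assms] by blast
  show "bdd_below {cube_expectation (\<lambda>x. norm (V x)) | V.
      \<forall>x\<in>cube. divergence V x = laplacian f x}"
    by (rule bdd_belowI[of _ 0]) (auto intro!: cube_expectation_nonneg)
qed

lemma beckmann_le_talagrand_frac:
  assumes "f \<in> cube \<rightarrow> {-1, 1}"
  shows "beckmann f \<le> talagrand_frac f"
proof -
  have "(\<lambda>_. 0) \<in> sensitive_edges f \<rightarrow> {0..1 :: real}"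
    by simp
  then show ?thesis
    unfolding talagrand_frac_def
    by (intro cINF_greatest beckmann_le_talagrand_fractional[OF assms]) blast
qed

text \<open>
  Squaring does nothing to \<open>0\<close> and \<open>1\<close>, so the two sums of squares count edges. All edges counted at
  \<open>x\<close> are red if \<open>f x = 1\<close> and blue if \<open>f x = -1\<close>, so the root is additive on the two counts.
\<close>

lemma talagrand_fractional_indicator:
  "talagrand_fractional f (\<lambda>e. of_bool (c e = Red)) = talagrand_coloring f c"
proof -
  have "sqrt ((\<Sum>i | f x = 1 \<and> f (flip x i) = -1. (of_bool (c {x, flip x i} = Red))\<^sup>2) +
              (\<Sum>i | f x = -1 \<and> f (flip x i) = 1. (1 - of_bool (c {x, flip x i} = Red))\<^sup>2))
        = sqrt (real (s_red f c x)) + sqrt (real (s_blue f c x))" for x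
  proof -
    have "(\<Sum>i | f x = 1 \<and> f (flip x i) = -1. (of_bool (c {x, flip x i} = Red) :: real)\<^sup>2)
        = real (s_red f c x)"
    proof -
      have "(of_bool (d = Red) :: real)\<^sup>2 = (if d = Red then 1 else 0)" for d
        by (cases d) auto
      then show ?thesis
        unfolding s_red_def by (simp add: sum.If_cases Int_def conj_ac)
    qed
    moreover have "(\<Sum>i | f x = -1 \<and> f (flip x i) = 1.
          (1 - of_bool (c {x, flip x i} = Red) :: real)\<^sup>2) = real (s_blue f c x)"
    proof -
      have "(1 - of_bool (d = Red) :: real)\<^sup>2 = (if d = Blue then 1 else 0)" for d
        by (cases d) auto
      then show ?thesis
        unfolding s_blue_def by (simp add: sum.If_cases Int_def conj_ac)
    qed
    moreover have "s_red f c x = 0 \<or> s_blue f c x = 0"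
      by (cases "f x = 1") (simp_all add: s_red_def s_blue_def)
    ultimately show ?thesis by auto
  qed
  then show ?thesis
    unfolding talagrand_fractional_def talagrand_coloring_def cube_expectation_add by simp
qed

lemma talagrand_frac_le_talagrand_coloring:
  "talagrand_frac f \<le> talagrand_coloring f c"
proof -
  have "bdd_below (talagrand_fractional f ` (sensitive_edges f \<rightarrow> {0..1}))"
    by (rule bdd_belowI2[of _ 0])
       (auto simp: talagrand_fractional_def intro!: cube_expectation_nonneg add_nonneg_nonneg sum_nonneg)
  moreover have "(\<lambda>e. of_bool (c e = Red)) \<in> sensitive_edges f \<rightarrow> {0..1 :: real}"
    by auto
  ultimately have "talagrand_frac f \<le> talagrand_fractional f (\<lambda>e. of_bool (c e = Red))"
    unfolding talagrand_frac_def by (rule cINF_lower)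
  then show ?thesis
    by (simp only: talagrand_fractional_indicator)
qed

lemma talagrand_frac_le_talagrand_col: "talagrand_frac f \<le> talagrand_col f"
proof -
  have "(\<lambda>_. Red) \<in> sensitive_edges f \<rightarrow> {Red, Blue}"
    by simp
  then show ?thesis
    unfolding talagrand_col_def
    by (intro cINF_greatest talagrand_frac_le_talagrand_coloring) blast
qed

lemma talagrand_col_le_talagrand_coloring:
  assumes "c \<in> sensitive_edges f \<rightarrow> {Red, Blue}"
  shows "talagrand_col f \<le> talagrand_coloring f c"
  unfolding talagrand_col_def
proof (rule cINF_lower[OF _ assms])
  show "bdd_below (talagrand_coloring f ` (sensitive_edges f \<rightarrow> {Red, Blue}))"
    by (rule bdd_belowI2[of _ 0])
       (auto simp: talagrand_coloring_def intro!: add_nonneg_nonneg cube_expectation_nonneg)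
qed

lemma talagrand_coloring_all_red:
  assumes "f \<in> cube \<rightarrow> {-1, 1}"
  shows "talagrand_coloring f (\<lambda>_. Red) =
    cube_expectation (\<lambda>x. sqrt (real (boundary_degree {y \<in> cube. f y = 1} x)))"
  unfolding talagrand_coloring_def cube_expectation_add
proof (rule cube_expectation_cong)
  fix x :: "real ^ 'a" assume x: "x \<in> cube"
  have "f x = 1 \<and> f (flip x i) = -1 \<longleftrightarrow>
      x \<in> {y \<in> cube. f y = 1} \<and> flip x i \<notin> {y \<in> cube. f y = 1}" for i
    by (rule sign_cases_along_edge[OF assms x, of i]) (simp_all add: x flip_in_cube)
  then show "sqrt (real (s_red f (\<lambda>_. Red) x)) + sqrt (real (s_blue f (\<lambda>_. Red) x)) =
      sqrt (real (boundary_degree {y \<in> cube. f y = 1} x))"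
    by (simp add: s_red_def s_blue_def boundary_degree_def)
qed

lemma talagrand_coloring_all_blue:
  assumes "f \<in> cube \<rightarrow> {-1, 1}"
  shows "talagrand_coloring f (\<lambda>_. Blue) =
    cube_expectation (\<lambda>x. sqrt (real (boundary_degree {y \<in> cube. f y = -1} x)))"
  unfolding talagrand_coloring_def cube_expectation_add
proof (rule cube_expectation_cong)
  fix x :: "real ^ 'a" assume x: "x \<in> cube"
  have "f x = -1 \<and> f (flip x i) = 1 \<longleftrightarrow>
      x \<in> {y \<in> cube. f y = -1} \<and> flip x i \<notin> {y \<in> cube. f y = -1}" for i
    by (rule sign_cases_along_edge[OF assms x, of i]) (simp_all add: x flip_in_cube)
  then show "sqrt (real (s_red f (\<lambda>_. Blue) x)) + sqrt (real (s_blue f (\<lambda>_. Blue) x)) =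
      sqrt (real (boundary_degree {y \<in> cube. f y = -1} x))"
    by (simp add: s_red_def s_blue_def boundary_degree_def)
qed

theorem proposition2p4:
  fixes f :: "real ^ 'n \<Rightarrow> real"
  assumes "f \<in> cube \<rightarrow> {-1, 1}"
  shows "(\<forall>c \<in> sensitive_edges f \<rightarrow> {Red, Blue}.
            beckmann f \<le> talagrand_frac f \<and>
            talagrand_frac f \<le> talagrand_col f \<and>
            talagrand_col f \<le> talagrand_coloring f c) \<and>
         (\<forall>c \<in> sensitive_edges f \<rightarrow> {Red, Blue}. beckmann f \<le> talagrand_coloring f c) \<and>
         beckmann f \<le> cube_expectation (\<lambda>x. sqrt (real (boundary_degree {y \<in> cube. f y = 1} x))) \<and>
         beckmann f \<le> cube_expectation (\<lambda>x. sqrt (real (boundary_degree {y \<in> cube. f y = -1} x)))"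
proof -
  note B_frac = beckmann_le_talagrand_frac[OF assms]
  have B_col: "beckmann f \<le> talagrand_coloring f c" for c
    using B_frac talagrand_frac_le_talagrand_coloring by (rule order_trans)
  show ?thesis
    using B_frac B_col B_col[of "\<lambda>_. Red"] B_col[of "\<lambda>_. Blue"]
      talagrand_frac_le_talagrand_col talagrand_col_le_talagrand_coloring
    unfolding talagrand_coloring_all_red[OF assms] talagrand_coloring_all_blue[OF assms]
    by blast
qed

end
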